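(* Let $q$ be a prime power, let $n\ge 2$ be an integer, and let $\Gamma$ be the singular difference graph of $M_n(\mathbb{F}_q)$. Then $\Gamma$ is Eulerian if and only if $q$ is odd.
   Context: $\mathbb{F}_q$ is the finite field with $q$ elements and $M_n(\mathbb{F}_q)$ is the vector space of all $n\times n$ matrices over $\mathbb{F}_q$. The singular difference graph $\Gamma$ of $M_n(\mathbb{F}_q)$ is the simple graph with vertex set $M_n(\mathbb{F}_q)$ in which two distinct matrices $A,B$ are adjacent if and only if $\det(A-B)=0$. A connected graph is Eulerian if it contains a closed trail (a closed walk with no repeated edge) that contains every edge of the graph exactly once; equivalently, if every vertex has even degree. *)

theory Defs
  imports "HOL-Library.Cardinality" "Jordan_Normal_Form.Determinant" "HOL-Number_Theory.Prime_Powers"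
begin

text \<open>An undirected graph is given by its vertices and its edges, each edge being the set of
  its two endpoints.\<close>

record 'v graph =
  verts :: "'v set"
  edges :: "'v set set"

definition simple_graph :: "'v graph \<Rightarrow> bool" where
  "simple_graph G \<longleftrightarrow> (\<forall>e \<in> edges G. e \<subseteq> verts G \<and> card e = 2)"

text \<open>A walk is represented by its nonempty list of successive vertices; the one-element list
  is the walk without edges. In a simple graph the vertices determine the traversed edges.\<close>

fun walk_edges :: "'v list \<Rightarrow> 'v set list" where
  "walk_edges (x # y # zs) = {x, y} # walk_edges (y # zs)"
| "walk_edges _ = []"

definition walk :: "'v graph \<Rightarrow> 'v list \<Rightarrow> bool" where
  "walk G xs \<longleftrightarrow> xs \<noteq> [] \<and> set xs \<subseteq> verts G \<and> set (walk_edges xs) \<subseteq> edges G"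

definition closed_trail :: "'v graph \<Rightarrow> 'v list \<Rightarrow> bool" where
  "closed_trail G xs \<longleftrightarrow> walk G xs \<and> hd xs = last xs \<and> distinct (walk_edges xs)"

definition connected_graph :: "'v graph \<Rightarrow> bool" where
  "connected_graph G \<longleftrightarrow> verts G \<noteq> {} \<and>
     (\<forall>u \<in> verts G. \<forall>v \<in> verts G. \<exists>xs. walk G xs \<and> hd xs = u \<and> last xs = v)"

definition eulerian :: "'v graph \<Rightarrow> bool" where
  "eulerian G \<longleftrightarrow> connected_graph G \<and>
     (\<exists>xs. closed_trail G xs \<and> edges G \<subseteq> set (walk_edges xs))"

definition singular_difference_graph :: "nat \<Rightarrow> 'a :: comm_ring_1 mat graph" where
  "singular_difference_graph n =
     \<lparr>verts = carrier_mat n n,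
      edges = {{A, B} | A B. A \<in> carrier_mat n n \<and> B \<in> carrier_mat n n \<and>
                             A \<noteq> B \<and> det (A - B) = 0}\<rparr>"

lemma simple_graph_singular_difference_graph: "simple_graph (singular_difference_graph n)"
  by (auto simp: simple_graph_def singular_difference_graph_def)

end

theory Submission
  imports Defs
begin

text \<open>A connected finite simple graph is Eulerian exactly when all its degrees are even
  (\<open>eulerian_iff_even_degrees\<close>), so two things have to be known about \<open>\<Gamma>\<close>.

  It is connected (\<open>connected_singular_difference_graph\<close>): for \<open>n \<ge> 2\<close>, replacing the first
  column of \<open>A\<close> by that of \<open>B\<close> gives a matrix \<open>C\<close> such that both \<open>A - C\<close> and \<open>C - B\<close> have a
  zero column, so that \<open>C\<close> is equal or adjacent to each of \<open>A\<close> and \<open>B\<close>.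

  It is regular (\<open>degree_singular_difference_graph\<close>): the edges at \<open>A\<close> correspond to the nonzero
  singular matrices \<open>X\<close> by \<open>X \<mapsto> {A, A - X}\<close>. The parity of this degree is found without counting
  singular matrices, by exhibiting fixed-point-free involutions. For odd \<open>q\<close>, the map
  \<open>X \<mapsto> - X\<close> pairs off the nonzero singular matrices, so the degree is even. For even \<open>q\<close>,
  exchanging two rows pairs off the invertible matrices, and \<open>X \<mapsto> X + J\<close>, with \<open>J\<close> the all-ones
  matrix, pairs off all matrices. Hence the number of singular matrices is even, and without
  the zero matrix an odd number remains.\<close>

section \<open>Walks\<close>

lemma walk_edges_join:
  assumes "xs \<noteq> []" "ys \<noteq> []" "last xs = hd ys"
  shows "walk_edges (xs @ tl ys) = walk_edges xs @ walk_edges ys"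
  using assms
proof (induction xs rule: walk_edges.induct)
  case (1 x y zs)
  then show ?case by simp
next
  case ("2_2" x)
  then show ?case by (cases ys) auto
qed simp

lemma length_walk_edges: "length (walk_edges xs) = length xs - 1"
  by (induction xs rule: walk_edges.induct) auto

lemma Union_walk_edges_subset: "\<Union> (set (walk_edges xs)) \<subseteq> set xs"
  by (induction xs rule: walk_edges.induct) auto

lemma walk_crosses_boundary:
  assumes "xs \<noteq> []" "hd xs \<in> V" "last xs \<notin> V"
  obtains x y where "x \<in> V" "y \<notin> V" "{x, y} \<in> set (walk_edges xs)"
proof -
  have "\<exists>x y. x \<in> V \<and> y \<notin> V \<and> {x, y} \<in> set (walk_edges xs)"
    using assms
  proof (induction xs rule: walk_edges.induct)
    case (1 x y zs)
    then show ?case by (cases "y \<in> V") auto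
  qed auto
  then show ?thesis using that by blast
qed

text \<open>Every visit in the interior of a walk uses two edges at the visited vertex, one to enter
  and one to leave; only the two ends of the walk contribute a single edge each.\<close>

lemma even_walk_edges_at_iff:
  assumes "xs \<noteq> []" "\<And>e. e \<in> set (walk_edges xs) \<Longrightarrow> card e = 2"
  shows "even (length (filter (\<lambda>e. v \<in> e) (walk_edges xs))) \<longleftrightarrow> (hd xs = v \<longleftrightarrow> last xs = v)"
  using assms
proof (induction xs rule: walk_edges.induct)
  case (1 x y zs)
  have "x \<noteq> y" using "1.prems"(2)[of "{x, y}"] by (auto simp: card_2_iff)
  then show ?case using 1 by auto
qed auto

section \<open>Euler's theorem\<close>

definition vertex_degree :: "'v graph \<Rightarrow> 'v \<Rightarrow> nat" where
  "vertex_degree G v = card {e \<in> edges G. v \<in> e}"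

definition trail :: "'v graph \<Rightarrow> 'v list \<Rightarrow> bool" where
  "trail G xs \<longleftrightarrow> walk G xs \<and> distinct (walk_edges xs)"

lemma card_walk_edges_at:
  assumes "distinct (walk_edges xs)"
  shows "card {e \<in> set (walk_edges xs). v \<in> e} = length (filter (\<lambda>e. v \<in> e) (walk_edges xs))"
  using distinct_card[of "filter (\<lambda>e. v \<in> e) (walk_edges xs)"] assms by simp

lemma trail_snoc:
  assumes "simple_graph G" "trail G xs" "{last xs, w} \<in> edges G"
    and "{last xs, w} \<notin> set (walk_edges xs)"
  shows "trail G (xs @ [w])"
proof -
  have ne: "xs \<noteq> []" using assms(2) by (auto simp: trail_def walk_def)
  have "walk_edges (xs @ [w]) = walk_edges xs @ [{last xs, w}]"
    using walk_edges_join[of xs "[last xs, w]"] ne by simp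
  moreover have "w \<in> verts G" using assms(1,3) by (auto simp: simple_graph_def)
  ultimately show ?thesis using assms by (auto simp: trail_def walk_def)
qed

text \<open>A closed trail may be started at any of its vertices.\<close>

lemma closed_trail_rotate:
  assumes "closed_trail G xs" "v \<in> set xs"
  obtains ys where "trail G ys" "last ys = v" "length ys = length xs"
    "set (walk_edges ys) = set (walk_edges xs)"
proof -
  obtain us vs where xs: "xs = us @ v # vs" using assms(2) by (meson split_list)
  define ys where "ys = (v # vs) @ tl (us @ [v])"
  have "walk_edges xs = walk_edges (us @ [v]) @ walk_edges (v # vs)"
    using walk_edges_join[of "us @ [v]" "v # vs"] xs by simp
  moreover have "walk_edges ys = walk_edges (v # vs) @ walk_edges (us @ [v])"
    unfolding ys_def using assms(1) xs
    by (intro walk_edges_join) (cases us; auto simp: closed_trail_def)+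
  moreover have "set ys \<subseteq> set xs" "length ys = length xs" "last ys = v" "ys \<noteq> []"
    using xs assms(1) by (cases us; auto simp: ys_def closed_trail_def)+
  moreover from calculation have "trail G ys" "set (walk_edges ys) = set (walk_edges xs)"
    using assms(1) by (auto simp: trail_def closed_trail_def walk_def)
  ultimately show ?thesis using that by blast
qed

text \<open>A trail of maximal length is an Eulerian circuit. Were it not closed, it would use an odd
  number of the evenly many edges at its last vertex, and one of the unused ones would extend it.
  Were some edge not used, connectedness would give an unused edge that meets the trail, and the
  closed trail, started at that meeting point, could be extended by this edge.\<close>

lemma even_degrees_imp_eulerian:
  assumes simple: "simple_graph G" and fin: "finite (edges G)" and conn: "connected_graph G"
    and even_deg: "\<And>v. v \<in> verts G \<Longrightarrow> even (vertex_degree G v)"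
  shows "eulerian G"
proof -
  have bound: "length xs \<le> card (edges G) + 1" if "trail G xs" for xs
  proof -
    have "card (set (walk_edges xs)) \<le> card (edges G)"
      using that fin by (intro card_mono) (auto simp: trail_def walk_def)
    then show ?thesis
      using that distinct_card[of "walk_edges xs"] by (simp add: trail_def length_walk_edges)
  qed
  obtain v0 where "v0 \<in> verts G" using conn by (auto simp: connected_graph_def)
  then have "trail G [v0]" by (auto simp: trail_def walk_def)
  then obtain xs where xs: "trail G xs" and longest: "\<And>ys. trail G ys \<Longrightarrow> length ys \<le> length xs"
    using ex_has_greatest_nat[of "trail G" "[v0]" length "card (edges G) + 2"] bound
    by fastforce
  have not_longer: "{last ys, w} \<in> set (walk_edges ys)"
    if "trail G ys" "length ys = length xs" "{last ys, w} \<in> edges G" for ys w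
    using trail_snoc[OF simple that(1,3)] longest[of "ys @ [w]"] that(2) by auto
  have ne: "xs \<noteq> []" and sub: "set (walk_edges xs) \<subseteq> edges G" and verts: "set xs \<subseteq> verts G"
    using xs by (auto simp: trail_def walk_def)
  have closed: "closed_trail G xs"
  proof (rule ccontr)
    let ?v = "last xs"
    assume "\<not> closed_trail G xs"
    then have "hd xs \<noteq> ?v" using xs by (auto simp: trail_def closed_trail_def)
    then have "odd (card {e \<in> set (walk_edges xs). ?v \<in> e})"
      using even_walk_edges_at_iff[OF ne, of ?v] card_walk_edges_at[of xs ?v] sub simple xs
      by (auto simp: trail_def simple_graph_def)
    moreover have "even (card {e \<in> edges G. ?v \<in> e})"
      using even_deg[of ?v] last_in_set[OF ne] verts by (auto simp: vertex_degree_def)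
    ultimately have "{e \<in> set (walk_edges xs). ?v \<in> e} \<noteq> {e \<in> edges G. ?v \<in> e}"
      by metis
    then obtain e where e: "e \<in> edges G" "?v \<in> e" "e \<notin> set (walk_edges xs)"
      using sub by blast
    have "card e = 2" using simple e(1) by (auto simp: simple_graph_def)
    then obtain w where "e = {?v, w}"
      using e(2) by (auto simp: card_2_iff insert_commute)
    then show False using not_longer[OF xs refl, of w] e by blast
  qed
  have "edges G \<subseteq> set (walk_edges xs)"
  proof
    fix e assume e: "e \<in> edges G"
    show "e \<in> set (walk_edges xs)"
    proof (rule ccontr)
      assume unused: "e \<notin> set (walk_edges xs)"
      obtain a b where ab: "e = {a, b}" using simple e by (auto simp: simple_graph_def card_2_iff)
      obtain x y where xy: "x \<in> set xs" "{x, y} \<in> edges G" "{x, y} \<notin> set (walk_edges xs)"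
      proof (cases "a \<in> set xs")
        case True
        then show ?thesis using that e unused ab by blast
      next
        case False
        have "a \<in> verts G" "hd xs \<in> verts G"
          using simple e ab ne verts by (auto simp: simple_graph_def)
        then obtain ws where ws: "walk G ws" "hd ws = hd xs" "last ws = a"
          using conn by (auto simp: connected_graph_def)
        obtain x y where "x \<in> set xs" "y \<notin> set xs" "{x, y} \<in> set (walk_edges ws)"
          using walk_crosses_boundary[of ws "set xs"] ws False ne by (auto simp: walk_def)
        then show ?thesis
          using that[of x y] ws(1) Union_walk_edges_subset[of xs] by (auto simp: walk_def)
      qed
      obtain ys where "trail G ys" "last ys = x" "length ys = length xs"
        "set (walk_edges ys) = set (walk_edges xs)"
        using closed_trail_rotate[OF closed xy(1)] .
      then show False using not_longer[of ys y] xy by auto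
    qed
  qed
  then show ?thesis using conn closed by (auto simp: eulerian_def)
qed

lemma eulerian_imp_even_degree:
  assumes simple: "simple_graph G" and "eulerian G"
  shows "even (vertex_degree G v)"
proof -
  obtain xs where xs: "closed_trail G xs" "edges G \<subseteq> set (walk_edges xs)"
    using assms(2) by (auto simp: eulerian_def)
  then have eq: "edges G = set (walk_edges xs)"
    by (auto simp: closed_trail_def walk_def)
  have "even (length (filter (\<lambda>e. v \<in> e) (walk_edges xs)))"
    using even_walk_edges_at_iff[of xs v] xs(1) simple eq
    by (auto simp: closed_trail_def walk_def simple_graph_def)
  then show ?thesis
    using card_walk_edges_at[of xs v] xs(1) by (simp add: vertex_degree_def eq closed_trail_def)
qed

theorem eulerian_iff_even_degrees:
  assumes "simple_graph G" "finite (edges G)" "connected_graph G"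
  shows "eulerian G \<longleftrightarrow> (\<forall>v \<in> verts G. even (vertex_degree G v))"
  using even_degrees_imp_eulerian[OF assms] eulerian_imp_even_degree[OF assms(1)] by blast

section \<open>Connectedness of the singular difference graph\<close>

lemma det_zero_column:
  fixes A :: "'a :: field mat"
  assumes A: "A \<in> carrier_mat n n" and "k < n" and zero: "\<And>i. i < n \<Longrightarrow> A $$ (i, k) = 0"
  shows "det A = 0"
proof -
  have "A *\<^sub>v unit_vec n k = 0\<^sub>v n"
    using assms by (intro eq_vecI) auto
  moreover have "unit_vec n k \<noteq> (0\<^sub>v n :: 'a vec)"
    using \<open>k < n\<close> by (metis index_unit_vec(1) index_zero_vec(1) zero_neq_one)
  ultimately show ?thesis
    using det_0_iff_vec_prod_zero_field[OF A] by (metis unit_vec_carrier)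
qed

lemma connected_singular_difference_graph:
  assumes "n \<ge> 2"
  shows "connected_graph (singular_difference_graph n :: 'a :: field mat graph)"
  unfolding connected_graph_def
proof (intro conjI ballI)
  let ?G = "singular_difference_graph n :: 'a mat graph"
  have "0\<^sub>m n n \<in> verts ?G" by (simp add: singular_difference_graph_def)
  then show "verts ?G \<noteq> {}" by blast
  fix A B assume "A \<in> verts ?G" "B \<in> verts ?G"
  then have A: "A \<in> carrier_mat n n" and B: "B \<in> carrier_mat n n"
    by (auto simp: singular_difference_graph_def)
  define C where "C = mat n n (\<lambda>(i, j). if j = 0 then B $$ (i, j) else A $$ (i, j))"
  have C: "C \<in> carrier_mat n n" by (simp add: C_def)
  have AC: "det (A - C) = 0"
    using assms A C by (intro det_zero_column[of _ n 1]) (auto simp: C_def)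
  have CB: "det (C - B) = 0"
    using assms B C by (intro det_zero_column[of _ n 0]) (auto simp: C_def)
  have edge: "{X, Y} \<in> edges ?G"
    if "X \<in> carrier_mat n n" "Y \<in> carrier_mat n n" "X \<noteq> Y" "det (X - Y) = 0" for X Y
    using that by (auto simp: singular_difference_graph_def)
  \<comment> \<open>Simple graphs have no loops, so a repeated vertex must be left out of the walk.\<close>
  define xs where "xs = (if A = C then [] else [A]) @ C # (if C = B then [] else [B])"
  have "walk ?G xs \<and> hd xs = A \<and> last xs = B"
    using edge[OF A C _ AC] edge[OF C B _ CB] A B C
    by (auto simp: xs_def walk_def singular_difference_graph_def)
  then show "\<exists>xs. walk ?G xs \<and> hd xs = A \<and> last xs = B" by blast
qed

section \<open>Degrees of the singular difference graph\<close>

definition nonzero_singular_mats :: "nat \<Rightarrow> 'a :: comm_ring_1 mat set" where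
  "nonzero_singular_mats n = {X \<in> carrier_mat n n. X \<noteq> 0\<^sub>m n n \<and> det X = 0}"

lemma finite_carrier_mat: "finite (carrier_mat m n :: 'a :: finite mat set)"
proof (rule finite_subset)
  show "carrier_mat m n \<subseteq> mat m n ` (({..<m} \<times> {..<n}) \<rightarrow>\<^sub>E (UNIV :: 'a set))"
  proof
    fix A :: "'a mat" assume "A \<in> carrier_mat m n"
    then have "A = mat m n (restrict (($$) A) ({..<m} \<times> {..<n}))" (is "_ = mat m n ?f")
      by (intro eq_matI) auto
    moreover have "?f \<in> ({..<m} \<times> {..<n}) \<rightarrow>\<^sub>E UNIV" by simp
    ultimately show "A \<in> mat m n ` (({..<m} \<times> {..<n}) \<rightarrow>\<^sub>E (UNIV :: 'a set))"
      by (rule image_eqI[where f = "mat m n"])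
  qed
qed (simp add: finite_PiE)

lemma finite_nonzero_singular_mats:
  "finite (nonzero_singular_mats n :: 'a :: {comm_ring_1, finite} mat set)"
  by (rule finite_subset[OF _ finite_carrier_mat]) (auto simp: nonzero_singular_mats_def)

lemma degree_singular_difference_graph:
  fixes A :: "'a :: {field, finite} mat"
  assumes A: "A \<in> carrier_mat n n"
  shows "vertex_degree (singular_difference_graph n) A = card (nonzero_singular_mats n :: 'a mat set)"
proof -
  let ?G = "singular_difference_graph n :: 'a mat graph"
  have inverse: "A - (A - X) = X" if "X \<in> carrier_mat n n" for X
    using A that by (intro eq_matI) auto
  have "bij_betw (\<lambda>X. {A, A - X}) (nonzero_singular_mats n) {e \<in> edges ?G. A \<in> e}"
  proof (rule bij_betw_imageI)
    show "inj_on (\<lambda>X. {A, A - X}) (nonzero_singular_mats n)"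
    proof (rule inj_onI)
      fix X Y assume "X \<in> nonzero_singular_mats n" "Y \<in> nonzero_singular_mats n"
        and "{A, A - X} = {A, A - Y}"
      moreover from this(3) have "A - X = A - Y" by (auto simp: doubleton_eq_iff)
      ultimately show "X = Y"
        using inverse by (metis (mono_tags, lifting) mem_Collect_eq nonzero_singular_mats_def)
    qed
    show "(\<lambda>X. {A, A - X}) ` nonzero_singular_mats n = {e \<in> edges ?G. A \<in> e}"
    proof (intro equalityI subsetI)
      fix e assume "e \<in> (\<lambda>X. {A, A - X}) ` nonzero_singular_mats n"
      then obtain X where X: "X \<in> carrier_mat n n" "X \<noteq> 0\<^sub>m n n" "det X = 0" "e = {A, A - X}"
        by (auto simp: nonzero_singular_mats_def)
      have "A \<noteq> A - X" using inverse[OF X(1)] X(2) A by (metis minus_r_inv_mat)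
      moreover have "A - X \<in> carrier_mat n n" using X(1) by (rule minus_carrier_mat)
      moreover have "det (A - (A - X)) = 0" using inverse[OF X(1)] X(3) by simp
      ultimately have "{A, A - X} \<in> edges ?G"
        using A by (auto simp only: singular_difference_graph_def graph.simps)
      then show "e \<in> {e \<in> edges ?G. A \<in> e}" using X(4) by simp
    next
      fix e assume "e \<in> {e \<in> edges ?G. A \<in> e}"
      then obtain B C where e: "e = {B, C}" "B \<in> carrier_mat n n" "C \<in> carrier_mat n n"
        "B \<noteq> C" "det (B - C) = 0" "A \<in> e"
        by (auto simp: singular_difference_graph_def)
      have "- (B - C) = C - B" using e(2,3) by (intro eq_matI) auto
      then have "det (C - B) = 0"
        using det_0_negate[OF minus_carrier_mat[OF e(3), of B]] e(5) by simp
      then obtain D where D: "e = {A, D}" "D \<in> carrier_mat n n" "A \<noteq> D" "det (A - D) = 0"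
        using e by (metis insertE insert_commute singletonD)
      have D': "A - (A - D) = D" by (rule inverse[OF D(2)])
      have "A - 0\<^sub>m n n = A" using A by (intro eq_matI) auto
      then have "A - D \<noteq> 0\<^sub>m n n" using D' D(3) by metis
      then have "A - D \<in> nonzero_singular_mats n"
        using D A by (simp add: nonzero_singular_mats_def minus_carrier_mat)
      then show "e \<in> (\<lambda>X. {A, A - X}) ` nonzero_singular_mats n"
        using D(1) D' by (metis (no_types, lifting) imageI)
    qed
  qed
  then show ?thesis by (simp add: vertex_degree_def bij_betw_same_card)
qed

section \<open>Parity by fixed-point-free involutions\<close>

lemma even_card_involution:
  assumes "finite S" "\<And>x. x \<in> S \<Longrightarrow> f x \<in> S" "\<And>x. x \<in> S \<Longrightarrow> f (f x) = x"
    and "\<And>x. x \<in> S \<Longrightarrow> f x \<noteq> x"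
  shows "even (card S)"
  using assms
proof (induction S rule: finite_psubset_induct)
  case (psubset S)
  show ?case
  proof (cases "S = {}")
    case False
    then obtain x where x: "x \<in> S" by blast
    let ?T = "S - {x, f x}"
    have "f y \<in> ?T" if "y \<in> ?T" for y
      using that psubset.prems x by (metis Diff_iff insertE insertI1 insertI2 singletonD)
    then have "even (card ?T)"
      using psubset.prems x by (intro psubset.IH) auto
    moreover have "card ?T = card S - 2" "card S \<ge> 2"
    proof -
      have "f x \<noteq> x" "{x, f x} \<subseteq> S" using psubset.prems x by auto
      then have "card {x, f x} = 2" by auto
      with \<open>{x, f x} \<subseteq> S\<close> show "card ?T = card S - 2" "card S \<ge> 2"
        using psubset.hyps card_Diff_subset[of "{x, f x}" S] card_mono[of S "{x, f x}"] by simp_all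
    qed
    ultimately show ?thesis by simp
  qed simp
qed

text \<open>In characteristic two the translation by \<open>1\<close>, and otherwise the negation of the nonzero
  elements, is a fixed-point-free involution.\<close>

lemma even_card_field_iff:
  "even CARD('a :: {field, finite}) \<longleftrightarrow> (1 + 1 :: 'a) = 0"
proof
  assume two: "(1 + 1 :: 'a) = 0"
  show "even CARD('a)"
    by (rule even_card_involution[where f = "\<lambda>x. x + 1"]) (use two in \<open>auto simp: add.assoc\<close>)
next
  assume "even CARD('a)"
  show "(1 + 1 :: 'a) = 0"
  proof (rule ccontr)
    assume two: "(1 + 1 :: 'a) \<noteq> 0"
    have "- x \<noteq> x" if "x \<noteq> 0" for x :: 'a
    proof
      assume "- x = x"
      then have "x * (1 + 1) = 0" by (metis add.left_inverse distrib_left mult_1_right)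
      then show False using that two by simp
    qed
    then have "even (card (UNIV - {0 :: 'a}))"
      by (intro even_card_involution[where f = uminus]) auto
    then show False using \<open>even CARD('a)\<close> by (simp add: card_Diff_singleton)
  qed
qed

lemma even_card_nonzero_singular_mats:
  assumes two: "(1 + 1 :: 'a :: {field, finite}) \<noteq> 0"
  shows "even (card (nonzero_singular_mats n :: 'a mat set))"
proof (rule even_card_involution[where f = uminus])
  fix X :: "'a mat" assume "X \<in> nonzero_singular_mats n"
  then have X: "X \<in> carrier_mat n n" "X \<noteq> 0\<^sub>m n n" "det X = 0"
    by (auto simp: nonzero_singular_mats_def)
  show "- X \<noteq> X"
  proof
    assume neg: "- X = X"
    have "X $$ (i, j) = 0" if "i < n" "j < n" for i j
    proof -
      have "- X $$ (i, j) = X $$ (i, j)" using neg X(1) that by (metis carrier_matD index_uminus_mat(1))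
      then have "X $$ (i, j) * (1 + 1) = 0" by (metis add.left_inverse distrib_left mult_1_right)
      then show ?thesis using two by simp
    qed
    then have "X = 0\<^sub>m n n" using X(1) by (intro eq_matI) auto
    then show False using X(2) by blast
  qed
  show "- (- X) = X" by (intro eq_matI) auto
  moreover have "- 0\<^sub>m n n = (0\<^sub>m n n :: 'a mat)" by (intro eq_matI) auto
  ultimately have "- X \<noteq> 0\<^sub>m n n" using X(2) by metis
  then show "- X \<in> nonzero_singular_mats n"
    using X by (simp add: nonzero_singular_mats_def det_0_negate[OF X(1)])
qed (rule finite_nonzero_singular_mats)

lemma even_card_invertible_mats:
  assumes "n \<ge> 2"
  shows "even (card {X \<in> carrier_mat n n. det (X :: 'a :: {field, finite} mat) \<noteq> 0})"
proof (rule even_card_involution[where f = "swaprows 0 1"])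
  fix X :: "'a mat" assume "X \<in> {X \<in> carrier_mat n n. det X \<noteq> 0}"
  then have X: "X \<in> carrier_mat n n" "det X \<noteq> 0" by auto
  show "swaprows 0 1 X \<in> {X \<in> carrier_mat n n. det X \<noteq> 0}"
    using X assms det_swaprows[of 0 n 1 X] by simp
  show "swaprows 0 1 (swaprows 0 1 X) = X"
    using X(1) assms by (intro eq_matI) auto
  show "swaprows 0 1 X \<noteq> X"
  proof
    assume swap: "swaprows 0 1 X = X"
    have "X $$ (0, j) = X $$ (1, j)" if "j < n" for j
      using arg_cong[OF swap, of "\<lambda>Y. Y $$ (0, j)"] X(1) assms that by auto
    then have "row X 0 = row X 1" using X(1) assms by (intro eq_vecI) auto
    then show False using det_identical_rows[OF X(1), of 0 1] X(2) assms by simp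
  qed
qed (rule finite_subset[OF _ finite_carrier_mat], blast)

lemma even_card_carrier_mat:
  assumes two: "(1 + 1 :: 'a :: {field, finite}) = 0" and "n > 0"
  shows "even (card (carrier_mat n n :: 'a mat set))"
proof (rule even_card_involution[where f = "\<lambda>X. X + mat n n (\<lambda>_. 1)"])
  fix X :: "'a mat" assume X: "X \<in> carrier_mat n n"
  show "X + mat n n (\<lambda>_. 1) + mat n n (\<lambda>_. 1) = X"
    using X two by (intro eq_matI) (auto simp: add.assoc)
  show "X + mat n n (\<lambda>_. 1) \<noteq> X"
  proof
    assume "X + mat n n (\<lambda>_. 1) = X"
    from arg_cong[OF this, of "\<lambda>Y. Y $$ (0, 0)"] show False using X \<open>n > 0\<close> by auto
  qed
qed (simp_all add: finite_carrier_mat)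

lemma odd_card_nonzero_singular_mats:
  assumes two: "(1 + 1 :: 'a :: {field, finite}) = 0" and n: "n \<ge> 2"
  shows "odd (card (nonzero_singular_mats n :: 'a mat set))"
proof -
  let ?M = "carrier_mat n n :: 'a mat set"
  let ?I = "{X \<in> ?M. det X \<noteq> 0}" and ?S = "nonzero_singular_mats n :: 'a mat set"
  have "det (0\<^sub>m n n :: 'a mat) = 0" using n by (intro det_zero_column[of _ n 0]) auto
  then have "?M = insert (0\<^sub>m n n) ?S \<union> ?I" "insert (0\<^sub>m n n) ?S \<inter> ?I = {}" "0\<^sub>m n n \<notin> ?S"
    by (auto simp: nonzero_singular_mats_def)
  moreover have "finite ?S" by (rule finite_nonzero_singular_mats)
  moreover have "finite ?I" by (rule finite_subset[OF _ finite_carrier_mat]) blast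
  ultimately have "card ?M = Suc (card ?S) + card ?I"
    by (metis (no_types, lifting) card_Un_disjoint card_insert_disjoint finite_insert)
  then show ?thesis
    using even_card_carrier_mat[OF two, of n] even_card_invertible_mats[OF n, where 'a = 'a] n by simp
qed

theorem theorem4p7:
  fixes q n :: nat and \<Gamma> :: "'a :: {field, finite} mat graph"
  assumes "primepow q" and "CARD('a) = q" and "n \<ge> 2"
    and "\<Gamma> = singular_difference_graph n"
  shows "eulerian \<Gamma> \<longleftrightarrow> odd q"
proof -
  have verts: "verts \<Gamma> = carrier_mat n n"
    using assms(4) by (simp add: singular_difference_graph_def)
  have simple: "simple_graph \<Gamma>"
    using assms(4) simple_graph_singular_difference_graph by blast
  then have "edges \<Gamma> \<subseteq> Pow (carrier_mat n n)"
    using verts by (auto simp: simple_graph_def)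
  then have fin: "finite (edges \<Gamma>)"
    using finite_carrier_mat by (metis finite_Pow_iff finite_subset)
  have conn: "connected_graph \<Gamma>"
    using assms connected_singular_difference_graph by blast
  have "0\<^sub>m n n \<in> verts \<Gamma>" using verts by simp
  then have "(\<forall>A \<in> verts \<Gamma>. even (vertex_degree \<Gamma> A)) \<longleftrightarrow> even (card (nonzero_singular_mats n :: 'a mat set))"
    using assms(4) verts degree_singular_difference_graph by metis
  also have "\<dots> \<longleftrightarrow> (1 + 1 :: 'a) \<noteq> 0"
    using even_card_nonzero_singular_mats odd_card_nonzero_singular_mats assms(3) by blast
  also have "\<dots> \<longleftrightarrow> odd q"
    using even_card_field_iff[where 'a = 'a] assms(2) by blast
  finally show ?thesis
    using eulerian_iff_even_degrees[OF simple fin conn] by blast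
qed

end
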